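(* Let $Z_{12},Z_{34}$ be real with $|Z_{12}|,|Z_{34}|<2m$, let $\theta_{12},\theta_{34}\in(-\pi/4,\pi/4)$ with $\sin2\theta_{12}=Z_{12}/(2m)$, $\sin2\theta_{34}=Z_{34}/(2m)$, let $e\in\mathbb C$, and consider the parity-invariant $\mathcal N=4$ super-Maxwell superamplitude $$\mathcal M=\frac{e}{m^3}\,x\,\big[S^{(1)}_{12}+S^{(2)}_{12}\big]\big[S^{(1)}_{34}+S^{(2)}_{34}\big].$$ Its component with both massive states of spin $2$ and a massless state of helicity $+1$ is $$M(\mathbf 1^{s=2},\mathbf 2^{s=2},P^{+1})=\frac{e}{m^3}\Big\{g_0\,x\langle\mathbf{12}\rangle^4+g_1\,x\langle\mathbf{12}\rangle^3\frac{\langle\mathbf 1|P|\mathbf 2]}{m}+g_2\,x\langle\mathbf{12}\rangle^2\Big(\frac{\langle\mathbf 1|P|\mathbf 2]}{m}\Big)^2\Big\}$$ with $$g_0=\Big(1-\frac{Z_{12}}{2m}\Big)\Big(1-\frac{Z_{34}}{2m}\Big),\qquad g_1=\frac{Z_{12}Z_{34}}{2m^2}-\frac{Z_{12}}{2m}-\frac{Z_{34}}{2m},\qquad g_2=\frac{Z_{12}Z_{34}}{4m^2}.$$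
   Context: Conventions. All two-valued indices are moved with $\epsilon^{12}=-\epsilon^{21}=1$, $\epsilon_{12}=-\epsilon_{21}=-1$. Repeated indices are summed. For undotted spinors $\lambda_\alpha,\mu_\alpha\in\mathbb C^2$: $\lambda^\alpha=\epsilon^{\alpha\beta}\lambda_\beta$, $\langle\lambda\mu\rangle=\lambda^\alpha\mu_\alpha$. For dotted spinors: $\tilde\mu^{\dot\alpha}=\epsilon^{\dot\alpha\dot\beta}\tilde\mu_{\dot\beta}$, $[\lambda\mu]=\tilde\lambda_{\dot\alpha}\tilde\mu^{\dot\alpha}$. Kinematics (fixed). $m>0$. For $i=1,2$ there are spinors $\lambda^I_{i\alpha},\tilde\lambda^I_{i\dot\alpha}$, $I=1,2$ (written $\mathbf i^I$ inside brackets) with $\langle \mathbf i^I\mathbf i^J\rangle=-m\epsilon^{IJ}$, $[\mathbf i^I\mathbf i^J]=m\epsilon^{IJ}$; $p_{i\alpha\dot\alpha}=\lambda^I_{i\alpha}\epsilon_{IJ}\tilde\lambda^J_{i\dot\alpha}$. There are nonzero spinors $\lambda_{P\alpha},\tilde\lambda_{P\dot\alpha}$ (written $P$ in brackets), $P_{\alpha\dot\alpha}=\lambda_{P\alpha}\tilde\lambda_{P\dot\alpha}$, and $p_1+p_2+P=0$. The nonzero number $x$ is defined by $x\lambda_{P\alpha}=\frac1m p_{1\alpha\dot\alpha}\tilde\lambda_P^{\dot\alpha}$. Also $\langle\mathbf1^I|P|\mathbf2^J]=\langle\mathbf1^IP\rangle[P\mathbf2^J]$. Grassmann algebra: complex,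 on generators $\eta^A_{iI}$ ($i,I\in\{1,2\}$, $A\in\{1,2,3,4\}$) and $\eta^A_P$ ($A\in\{1,2,3,4\}$). Put $\sigma_1=1,\sigma_2=-1$, fix reference spinors with $\langle\zeta P\rangle\ne0$, $[\xi P]\ne0$, and set $$\delta^A=\sum_i\langle P\mathbf i^I\rangle\eta^A_{iI},\quad \mathcal H^A=\frac{1}{\langle\zeta P\rangle}\sum_i\langle\zeta\mathbf i^I\rangle\eta^A_{iI},\quad \bar{\mathcal H}^A=\frac1{[\xi P]}\sum_i[\xi\mathbf i^I]\sigma_i\eta^A_{iI}.$$ For $(a,b)=(1,2)$ or $(3,4)$ put $\bar{\mathcal H}_a=-\bar{\mathcal H}^b$, $\bar{\mathcal H}_b=\bar{\mathcal H}^a$, $c=\cos\theta_{ab}$, $s=\sin\theta_{ab}$, and $$S^{(1)}_{ab}=\big(c\,\eta_P^a\delta^a-\delta^a\mathcal H^a-cs\,\delta^a\bar{\mathcal H}_b\eta_P^a\eta_P^b+s\,\delta^a\mathcal H^a\bar{\mathcal H}_b\eta_P^b\big)\big(c\,\eta_P^b\delta^b-\delta^b\mathcal H^b+cs\,\delta^b\bar{\mathcal H}_a\eta_P^a\eta_P^b+s\,\delta^b\mathcal H^b\bar{\mathcal H}_a\eta_P^a\big),$$ $$S^{(2)}_{ab}=-x\big(c\,\delta^a\mathcal H^a\bar{\mathcal H}_a+\delta^a\eta_P^a\bar{\mathcal H}_a+s\,\delta^a\big)\big(c\,\delta^b\mathcal H^b\bar{\mathcal H}_b+\delta^b\eta_P^b\bar{\mathcal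 H}_b+s\,\delta^b\big).$$ Component: the part of $\mathcal M$ of degree $0$ in $\eta_P$ and of degree exactly one in $\eta_1^A$ and exactly one in $\eta_2^A$ for each $A=1,\dots,4$ is written $C^{I_1I_2I_3I_4,J_1J_2J_3J_4}\prod_{A=1}^4\eta^A_{1I_A}\eta^A_{2J_A}$; $M(\mathbf1^{s=2},\mathbf2^{s=2},P^{+1})$ is the tensor $C$ totally symmetrized in $I_1,\dots,I_4$ and totally symmetrized in $J_1,\dots,J_4$. On the right-hand side of the claim the indices $I$ of $\mathbf 1$ and $J$ of $\mathbf 2$ are suppressed and likewise totally symmetrized with unit weight, e.g. $\langle\mathbf{12}\rangle^4$ stands for the symmetrization of $\prod_{k=1}^4\langle\mathbf1^{I_k}\mathbf2^{J_k}\rangle$. *)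

theory Defs
  imports "HOL-Analysis.Analysis"
begin

section \<open>Finite-dimensional complex Grassmann algebras\<close>

text \<open>
  The Grassmann algebra over the complex numbers on a finite, linearly ordered type of generators,
  realised on the basis of increasing monomials: an element is the family of its coefficients,
  indexed by sets of generators. A product of two disjoint increasing monomials \<open>S\<close>, \<open>T\<close> is the
  increasing monomial \<open>S \<union> T\<close> times \<open>-1\<close> to the number of inversions.
\<close>

typedef 'g grassmann = "UNIV :: ('g set \<Rightarrow> complex) set"
  morphisms gcoeff Abs_grassmann ..

declare Abs_grassmann_inverse [simplified, simp]

lemma grassmann_eqI: "(\<And>S. gcoeff f S = gcoeff g S) \<Longrightarrow> f = g"
  by (metis ext gcoeff_inject)

definition gsign :: "'g::linorder set \<Rightarrow> 'g set \<Rightarrow> complex" where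
  "gsign S T = (- 1) ^ card {(s, t). s \<in> S \<and> t \<in> T \<and> t < s}"

lemma gsign_empty [simp]: "gsign {} T = 1" "gsign S {} = 1"
  by (simp_all add: gsign_def)

lemma gsign_Un_left:
  fixes S T V :: "'g::{finite,linorder} set"
  assumes "S \<inter> T = {}"
  shows "gsign (S \<union> T) V = gsign S V * gsign T V"
proof -
  have "{(s, t). s \<in> S \<union> T \<and> t \<in> V \<and> t < s}
      = {(s, t). s \<in> S \<and> t \<in> V \<and> t < s} \<union> {(s, t). s \<in> T \<and> t \<in> V \<and> t < s}" by auto
  moreover have "{(s, t). s \<in> S \<and> t \<in> V \<and> t < s} \<inter> {(s, t). s \<in> T \<and> t \<in> V \<and> t < s} = {}"
    using assms by auto
  ultimately show ?thesis by (simp add: gsign_def card_Un_disjoint power_add)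
qed

lemma gsign_Un_right:
  fixes S T V :: "'g::{finite,linorder} set"
  assumes "T \<inter> V = {}"
  shows "gsign S (T \<union> V) = gsign S T * gsign S V"
proof -
  have "{(s, t). s \<in> S \<and> t \<in> T \<union> V \<and> t < s}
      = {(s, t). s \<in> S \<and> t \<in> T \<and> t < s} \<union> {(s, t). s \<in> S \<and> t \<in> V \<and> t < s}" by auto
  moreover have "{(s, t). s \<in> S \<and> t \<in> T \<and> t < s} \<inter> {(s, t). s \<in> S \<and> t \<in> V \<and> t < s} = {}"
    using assms by auto
  ultimately show ?thesis by (simp add: gsign_def card_Un_disjoint power_add)
qed

instantiation grassmann :: ("{finite,linorder}") ring_1
begin

definition "0 = Abs_grassmann (\<lambda>_. 0)"
definition "1 = Abs_grassmann (\<lambda>S. if S = {} then 1 else 0)"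
definition "f + g = Abs_grassmann (\<lambda>S. gcoeff f S + gcoeff g S)"
definition "f - g = Abs_grassmann (\<lambda>S. gcoeff f S - gcoeff g S)"
definition "- f = Abs_grassmann (\<lambda>S. - gcoeff f S)"
definition "f * g =
  Abs_grassmann (\<lambda>U. \<Sum>S\<in>Pow U. gsign S (U - S) * gcoeff f S * gcoeff g (U - S))"

instance
proof
  fix a b c :: "'a grassmann"
  show "a * b * c = a * (b * c)"
  proof (rule grassmann_eqI)
    fix U
    define h where "h = (\<lambda>S T. gsign S T * gsign S (U - S - T) * gsign T (U - S - T)
      * gcoeff a S * gcoeff b T * gcoeff c (U - S - T))"
    have "gcoeff (a * b * c) U = (\<Sum>W\<in>Pow U. \<Sum>S\<in>Pow W. h S (W - S))"
    proof -
      have "gsign W (U - W) * (gsign S (W - S) * gcoeff a S * gcoeff b (W - S)) * gcoeff c (U - W)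
          = h S (W - S)" if "W \<subseteq> U" "S \<subseteq> W" for W S
      proof -
        have 1: "U - S - (W - S) = U - W" using that by auto
        have "gsign W (U - W) = gsign S (U - W) * gsign (W - S) (U - W)"
          using gsign_Un_left[of S "W - S" "U - W"] that by (simp add: Un_absorb1)
        then show ?thesis by (simp add: h_def 1 mult_ac)
      qed
      then show ?thesis
        by (auto simp: times_grassmann_def sum_distrib_left sum_distrib_right intro!: sum.cong)
    qed
    also have "\<dots> = (\<Sum>(W, S)\<in>Sigma (Pow U) Pow. h S (W - S))"
      by (simp add: sum.Sigma)
    also have "\<dots> = (\<Sum>(S, T)\<in>Sigma (Pow U) (\<lambda>S. Pow (U - S)). h S T)"
      by (rule sum.reindex_bij_witness[where i = "\<lambda>(S, T). (S \<union> T, S)" and j = "\<lambda>(W, S). (S, W - S)"])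
        auto
    also have "\<dots> = (\<Sum>S\<in>Pow U. \<Sum>T\<in>Pow (U - S). h S T)"
      by (simp add: sum.Sigma)
    also have "\<dots> = gcoeff (a * (b * c)) U"
    proof -
      have "gsign S (U - S) * gcoeff a S * (gsign T (U - S - T) * gcoeff b T * gcoeff c (U - S - T))
          = h S T" if "S \<subseteq> U" "T \<subseteq> U - S" for S T
      proof -
        have "gsign S (U - S) = gsign S T * gsign S (U - S - T)"
          using gsign_Un_right[of T "U - S - T" S] that by (simp add: Un_absorb1)
        then show ?thesis by (simp add: h_def mult_ac)
      qed
      then show ?thesis
        by (auto simp: times_grassmann_def sum_distrib_left sum_distrib_right intro!: sum.cong)
    qed
    finally show "gcoeff (a * b * c) U = gcoeff (a * (b * c)) U" .
  qed
  show "(a + b) * c = a * c + b * c" "a * (b + c) = a * b + a * c"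
    by (rule grassmann_eqI,
        simp add: times_grassmann_def plus_grassmann_def distrib_left distrib_right sum.distrib)+
  show "1 * a = a"
  proof (rule grassmann_eqI)
    fix U
    have "gcoeff (1 * a) U = (\<Sum>S\<in>Pow U. gsign S (U - S) * gcoeff 1 S * gcoeff a (U - S))"
      by (simp add: times_grassmann_def)
    also have "\<dots> = (\<Sum>S\<in>Pow U. if S = {} then gcoeff a U else 0)"
      by (rule sum.cong) (auto simp: one_grassmann_def)
    finally have "gcoeff (1 * a) U = (\<Sum>S\<in>Pow U. if S = {} then gcoeff a U else 0)" .
    then show "gcoeff (1 * a) U = gcoeff a U" by simp
  qed
  show "a * 1 = a"
  proof (rule grassmann_eqI)
    fix U
    have "gcoeff (a * 1) U = (\<Sum>S\<in>Pow U. gsign S (U - S) * gcoeff a S * gcoeff 1 (U - S))"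
      by (simp add: times_grassmann_def)
    also have "\<dots> = (\<Sum>S\<in>Pow U. if S = U then gcoeff a U else 0)"
      by (rule sum.cong) (auto simp: one_grassmann_def)
    finally have "gcoeff (a * 1) U = (\<Sum>S\<in>Pow U. if S = U then gcoeff a U else 0)" .
    then show "gcoeff (a * 1) U = gcoeff a U" by simp
  qed
  show "(0 :: 'a grassmann) \<noteq> 1"
  proof
    assume "(0 :: 'a grassmann) = 1"
    then have "gcoeff (0 :: 'a grassmann) {} = gcoeff (1 :: 'a grassmann) {}" by simp
    then show False by (simp add: zero_grassmann_def one_grassmann_def)
  qed
qed (auto intro!: grassmann_eqI
    simp: plus_grassmann_def zero_grassmann_def minus_grassmann_def uminus_grassmann_def)

end

lemma gcoeff_mult:
  fixes f g :: "'g::{finite,linorder} grassmann"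
  shows "gcoeff (f * g) U = (\<Sum>S\<in>Pow U. gsign S (U - S) * gcoeff f S * gcoeff g (U - S))"
  by (simp add: times_grassmann_def)

definition gbasis :: "'g set \<Rightarrow> 'g grassmann" where
  "gbasis S = Abs_grassmann (\<lambda>T. if T = S then 1 else 0)"

definition gconst :: "complex \<Rightarrow> 'g grassmann" where
  "gconst c = Abs_grassmann (\<lambda>T. if T = {} then c else 0)"

definition gvar :: "'g \<Rightarrow> 'g grassmann" where
  "gvar g = gbasis {g}"

lemma gcoeff_simps [simp]:
  fixes f g :: "'g::{finite,linorder} grassmann"
  shows "gcoeff (f + g) S = gcoeff f S + gcoeff g S"
    "gcoeff (f - g) S = gcoeff f S - gcoeff g S"
    "gcoeff (- f) S = - gcoeff f S"
    "gcoeff (0 :: 'g grassmann) S = 0"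
  by (simp_all add: plus_grassmann_def minus_grassmann_def uminus_grassmann_def zero_grassmann_def)

lemma gcoeff_gbasis: "gcoeff (gbasis S) T = (if T = S then 1 else 0)"
  by (simp add: gbasis_def)

lemma gcoeff_sum [simp]:
  fixes f :: "'a \<Rightarrow> 'g::{finite,linorder} grassmann"
  shows "gcoeff (sum f A) S = (\<Sum>a\<in>A. gcoeff (f a) S)"
  by (induction A rule: infinite_finite_induct) auto

lemma gcoeff_gconst_mult [simp]:
  fixes f :: "'g::{finite,linorder} grassmann"
  shows "gcoeff (gconst c * f) S = c * gcoeff f S" "gcoeff (f * gconst c) S = c * gcoeff f S"
proof -
  have "gcoeff (gconst c * f) S = (\<Sum>T\<in>Pow S. if T = {} then c * gcoeff f S else 0)"
    unfolding gcoeff_mult by (rule sum.cong) (auto simp: gconst_def)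
  then show "gcoeff (gconst c * f) S = c * gcoeff f S" by simp
  have "gcoeff (f * gconst c) S = (\<Sum>T\<in>Pow S. if T = S then c * gcoeff f S else 0)"
    unfolding gcoeff_mult by (rule sum.cong) (auto simp: gconst_def)
  then show "gcoeff (f * gconst c) S = c * gcoeff f S" by simp
qed

lemma gbasis_mult:
  fixes S T :: "'g::{finite,linorder} set"
  shows "gbasis S * gbasis T = (if S \<inter> T = {} then gconst (gsign S T) * gbasis (S \<union> T) else 0)"
proof (rule grassmann_eqI)
  fix U
  have "gcoeff (gbasis S * gbasis T) U
      = (\<Sum>W\<in>Pow U. if W = S then (if U - S = T then gsign S T else 0) else 0)"
    unfolding gcoeff_mult by (rule sum.cong) (auto simp: gcoeff_gbasis)
  also have "\<dots> = (if S \<subseteq> U \<and> U - S = T then gsign S T else 0)"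
    by simp
  also have "\<dots> = (if S \<inter> T = {} \<and> U = S \<union> T then gsign S T else 0)"
    by (rule if_cong) auto
  finally show "gcoeff (gbasis S * gbasis T) U =
      gcoeff (if S \<inter> T = {} then gconst (gsign S T) * gbasis (S \<union> T) else 0) U"
    by (simp add: gcoeff_gbasis)
qed

lemma gbasis_mult_increasing:
  fixes S T :: "'g::{finite,linorder} set"
  assumes "\<And>s t. s \<in> S \<Longrightarrow> t \<in> T \<Longrightarrow> s < t"
  shows "gbasis S * gbasis T = gbasis (S \<union> T)"
proof -
  have "{(s, t). s \<in> S \<and> t \<in> T \<and> t < s} = {}" "S \<inter> T = {}"
    using assms by (auto dest: less_asym)
  then have "gsign S T = 1" by (simp only: gsign_def) simp
  with \<open>S \<inter> T = {}\<close> show ?thesis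
    by (intro grassmann_eqI) (simp add: gbasis_mult)
qed

lemma gsign_singleton: "gsign {g} {h} = (if h < g then - 1 else 1)"
proof -
  have "{(s, t). s \<in> {g} \<and> t \<in> {h} \<and> t < s} = (if h < g then {(g, h)} else {})" by auto
  then show ?thesis by (simp only: gsign_def) simp
qed

lemma gvar_anticommute:
  fixes g h :: "'g::{finite,linorder}"
  shows "gvar g * gvar h = - (gvar h * gvar g)"
proof -
  have "{h, g} = {g, h}" by auto
  then show ?thesis
    by (cases g h rule: linorder_cases; intro grassmann_eqI)
      (simp_all add: gvar_def gbasis_mult gsign_singleton gcoeff_gbasis)
qed


section \<open>The on-shell superspace generators\<close>

text \<open>
  Two-valued indices live in the type \<open>2\<close>, whose elements are \<open>1\<close> and \<open>2 = 0\<close>, and R-symmetry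
  indices in the type \<open>4\<close>, whose elements are \<open>1\<close>, \<open>2\<close>, \<open>3\<close> and \<open>4 = 0\<close>. \<open>Eta A i I\<close> is the
  generator of upper index \<open>A\<close> and lower indices \<open>i I\<close>. The order of the generators is an
  auxiliary choice, needed only for the basis of increasing monomials.
\<close>

datatype gen = Eta 4 2 2 | EtaP 4

instance gen :: finite
proof
  have "(UNIV :: gen set) = (\<lambda>(A, i, I). Eta A i I) ` UNIV \<union> range EtaP"
  proof (intro set_eqI iffI UNIV_I)
    fix g :: gen
    show "g \<in> (\<lambda>(A, i, I). Eta A i I) ` UNIV \<union> range EtaP"
      by (cases g) (auto simp: image_iff)
  qed
  then show "finite (UNIV :: gen set)" by (metis finite finite_UnI finite_imageI)
qed

definition pos2 :: "2 \<Rightarrow> nat" where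
  "pos2 i = (if i = 1 then 0 else 1)"

definition pos4 :: "4 \<Rightarrow> nat" where
  "pos4 A = (if A = 1 then 0 else if A = 2 then 1 else if A = 3 then 2 else 3)"

fun gen_pos :: "gen \<Rightarrow> nat" where
  "gen_pos (Eta A i I) = 4 * pos4 A + 2 * pos2 i + pos2 I"
| "gen_pos (EtaP A) = 16 + pos4 A"

lemma gen_pos_inject: "gen_pos g = gen_pos h \<Longrightarrow> g = h"
proof -
  have 2: "i = j" if "pos2 i = pos2 j" for i j
    using that exhaust_2[of i] exhaust_2[of j] by (auto simp: pos2_def split: if_splits)
  have 4: "A = B" if "pos4 A = pos4 B" for A B
    using that exhaust_4[of A] exhaust_4[of B] unfolding pos4_def
    by (elim disjE) (simp_all split: if_splits)
  have b2: "pos2 i \<le> 1" for i by (simp add: pos2_def)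
  have b4: "pos4 A \<le> 3" for A by (simp add: pos4_def)
  assume eq: "gen_pos g = gen_pos h"
  show "g = h"
  proof (cases g; cases h)
    fix A i I B j J
    assume gh: "g = Eta A i I" "h = Eta B j J"
    then have "4 * pos4 A + 2 * pos2 i + pos2 I = 4 * pos4 B + 2 * pos2 j + pos2 J"
      using eq by simp
    moreover have "a = b \<and> c = d \<and> e = f"
      if "4 * a + 2 * c + e = 4 * b + 2 * d + f" "c \<le> 1" "d \<le> 1" "e \<le> 1" "f \<le> 1"
      for a b c d e f :: nat
      using that by presburger
    ultimately have "pos4 A = pos4 B \<and> pos2 i = pos2 j \<and> pos2 I = pos2 J"
      using b2 by blast
    then show ?thesis using gh 2 4 by simp
  next
    fix A i I B
    assume "g = Eta A i I" "h = EtaP B"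
    then show ?thesis using eq b4[of A] b2[of i] b2[of I] by simp
  next
    fix A B j J
    assume "g = EtaP A" "h = Eta B j J"
    then show ?thesis using eq b4[of B] b2[of j] b2[of J] by simp
  next
    fix A B
    assume "g = EtaP A" "h = EtaP B"
    then show ?thesis using eq 4 by simp
  qed
qed

instantiation gen :: linorder
begin
definition "g \<le> h \<longleftrightarrow> gen_pos g \<le> gen_pos h"
definition "g < h \<longleftrightarrow> gen_pos g < gen_pos h"
instance
  by standard (auto simp: less_eq_gen_def less_gen_def intro: gen_pos_inject)
end

abbreviation eta :: "4 \<Rightarrow> 2 \<Rightarrow> 2 \<Rightarrow> gen grassmann" where
  "eta A i I \<equiv> gvar (Eta A i I)"

abbreviation etaP :: "4 \<Rightarrow> gen grassmann" where
  "etaP A \<equiv> gvar (EtaP A)"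


section \<open>Spinors and kinematics\<close>

type_synonym spinor = "complex ^ 2"

definition eps_up :: "2 \<Rightarrow> 2 \<Rightarrow> complex" where
  "eps_up a b = (if a = 1 \<and> b = 2 then 1 else if a = 2 \<and> b = 1 then - 1 else 0)"

definition eps_dn :: "2 \<Rightarrow> 2 \<Rightarrow> complex" where
  "eps_dn a b = (if a = 1 \<and> b = 2 then - 1 else if a = 2 \<and> b = 1 then 1 else 0)"

text \<open>Spinors, undotted and dotted alike, are given by their lower components.\<close>

definition raise_index :: "spinor \<Rightarrow> spinor" where
  "raise_index u = (\<chi> a. \<Sum>b\<in>UNIV. eps_up a b * u $ b)"

definition angle_br :: "spinor \<Rightarrow> spinor \<Rightarrow> complex" where
  "angle_br u v = (\<Sum>a\<in>UNIV. raise_index u $ a * v $ a)"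

definition square_br :: "spinor \<Rightarrow> spinor \<Rightarrow> complex" where
  "square_br u v = (\<Sum>a\<in>UNIV. u $ a * raise_index v $ a)"

text \<open>Momentum bispinors; rows carry the undotted and columns the dotted index.\<close>

definition massive_momentum :: "(2 \<Rightarrow> spinor) \<Rightarrow> (2 \<Rightarrow> spinor) \<Rightarrow> complex ^ 2 ^ 2" where
  "massive_momentum l lt =
    (\<chi> a d. \<Sum>I\<in>UNIV. \<Sum>J\<in>UNIV. l I $ a * eps_dn I J * lt J $ d)"

definition massless_momentum :: "spinor \<Rightarrow> spinor \<Rightarrow> complex ^ 2 ^ 2" where
  "massless_momentum lP ltP = (\<chi> a d. lP $ a * ltP $ d)"

definition sandwich :: "spinor \<Rightarrow> spinor \<Rightarrow> spinor \<Rightarrow> spinor \<Rightarrow> complex" where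
  "sandwich u lP ltP v = angle_br u lP * square_br ltP v"


section \<open>The superamplitude\<close>

definition supercharge_delta ::
    "(2 \<Rightarrow> 2 \<Rightarrow> spinor) \<Rightarrow> spinor \<Rightarrow> 4 \<Rightarrow> gen grassmann" where
  "supercharge_delta l lP A =
    (\<Sum>i\<in>UNIV. \<Sum>I\<in>UNIV. gconst (angle_br lP (l i I)) * eta A i I)"

definition calH ::
    "(2 \<Rightarrow> 2 \<Rightarrow> spinor) \<Rightarrow> spinor \<Rightarrow> spinor \<Rightarrow> 4 \<Rightarrow> gen grassmann" where
  "calH l lP \<zeta> A =
    gconst (1 / angle_br \<zeta> lP) * (\<Sum>i\<in>UNIV. \<Sum>I\<in>UNIV. gconst (angle_br \<zeta> (l i I)) * eta A i I)"

definition leg_sign :: "2 \<Rightarrow> complex" where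
  "leg_sign i = (if i = 1 then 1 else - 1)"

definition calH_bar ::
    "(2 \<Rightarrow> 2 \<Rightarrow> spinor) \<Rightarrow> spinor \<Rightarrow> spinor \<Rightarrow> 4 \<Rightarrow> gen grassmann" where
  "calH_bar lt ltP \<xi> A =
    gconst (1 / square_br \<xi> ltP) *
    (\<Sum>i\<in>UNIV. \<Sum>I\<in>UNIV. gconst (square_br \<xi> (lt i I) * leg_sign i) * eta A i I)"

text \<open>
  The factors for an R-symmetry pair \<open>(a, b)\<close>, as polynomials in \<open>D = \<delta>\<close>, \<open>H\<close> and \<open>Hb\<close> (the barred
  \<open>H\<close> with upper index); \<open>Hba\<close> and \<open>Hbb\<close> are its components with lower index.
\<close>

definition S1 ::
    "real \<Rightarrow> (4 \<Rightarrow> gen grassmann) \<Rightarrow> (4 \<Rightarrow> gen grassmann) \<Rightarrow> (4 \<Rightarrow> gen grassmann)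
      \<Rightarrow> 4 \<Rightarrow> 4 \<Rightarrow> gen grassmann" where
  "S1 \<theta> D H Hb a b =
    (let Hba = - Hb b; Hbb = Hb a;
         c = gconst (complex_of_real (cos \<theta>)); s = gconst (complex_of_real (sin \<theta>))
     in (c * etaP a * D a - D a * H a
           - c * s * D a * Hbb * etaP a * etaP b + s * D a * H a * Hbb * etaP b)
      * (c * etaP b * D b - D b * H b
           + c * s * D b * Hba * etaP a * etaP b + s * D b * H b * Hba * etaP a))"

definition S2 ::
    "complex \<Rightarrow> real \<Rightarrow> (4 \<Rightarrow> gen grassmann) \<Rightarrow> (4 \<Rightarrow> gen grassmann) \<Rightarrow> (4 \<Rightarrow> gen grassmann)
      \<Rightarrow> 4 \<Rightarrow> 4 \<Rightarrow> gen grassmann" where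
  "S2 x \<theta> D H Hb a b =
    (let Hba = - Hb b; Hbb = Hb a;
         c = gconst (complex_of_real (cos \<theta>)); s = gconst (complex_of_real (sin \<theta>))
     in - gconst x
      * (c * D a * H a * Hba + D a * etaP a * Hba + s * D a)
      * (c * D b * H b * Hbb + D b * etaP b * Hbb + s * D b))"

definition superamplitude ::
    "complex \<Rightarrow> real \<Rightarrow> complex \<Rightarrow> real \<Rightarrow> real
      \<Rightarrow> (4 \<Rightarrow> gen grassmann) \<Rightarrow> (4 \<Rightarrow> gen grassmann) \<Rightarrow> (4 \<Rightarrow> gen grassmann)
      \<Rightarrow> gen grassmann" where
  "superamplitude e m x \<theta>12 \<theta>34 D H Hb =
    gconst (e / complex_of_real m ^ 3 * x)
    * (S1 \<theta>12 D H Hb 1 2 + S2 x \<theta>12 D H Hb 1 2)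
    * (S1 \<theta>34 D H Hb 3 4 + S2 x \<theta>34 D H Hb 3 4)"


section \<open>The component with two spin-2 states and a massless state of helicity +1\<close>

text \<open>Degree \<open>0\<close> in \<open>\<eta>_P\<close> and degree one in each of the families \<open>(\<eta>\<^sup>A\<^sub>i\<^sub>I)\<^sub>I\<close>.\<close>

definition spin2_degree :: "gen set \<Rightarrow> bool" where
  "spin2_degree S \<longleftrightarrow> card (S \<inter> range EtaP) = 0 \<and> (\<forall>A i. card (S \<inter> range (Eta A i)) = 1)"

definition spin2_part :: "gen grassmann \<Rightarrow> gen grassmann" where
  "spin2_part M = Abs_grassmann (\<lambda>S. if spin2_degree S then gcoeff M S else 0)"

definition spin2_monomial :: "(4 \<Rightarrow> 2) \<Rightarrow> (4 \<Rightarrow> 2) \<Rightarrow> gen grassmann" where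
  "spin2_monomial I J = prod_list (map (\<lambda>A. eta A 1 (I A) * eta A 2 (J A)) [1, 2, 3, 4])"

definition spin2_tensor :: "gen grassmann \<Rightarrow> (4 \<Rightarrow> 2) \<Rightarrow> (4 \<Rightarrow> 2) \<Rightarrow> complex" where
  "spin2_tensor M = (THE C. spin2_part M =
    (\<Sum>I\<in>UNIV. \<Sum>J\<in>UNIV. gconst (C I J) * spin2_monomial I J))"

definition symmetrize ::
    "((4 \<Rightarrow> 2) \<Rightarrow> (4 \<Rightarrow> 2) \<Rightarrow> complex) \<Rightarrow> (4 \<Rightarrow> 2) \<Rightarrow> (4 \<Rightarrow> 2) \<Rightarrow> complex" where
  "symmetrize T I J =
    (\<Sum>\<pi> | \<pi> permutes UNIV. \<Sum>\<rho> | \<rho> permutes UNIV. T (I \<circ> \<pi>) (J \<circ> \<rho>)) / (fact 4 * fact 4)"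

definition spin2_component :: "gen grassmann \<Rightarrow> (4 \<Rightarrow> 2) \<Rightarrow> (4 \<Rightarrow> 2) \<Rightarrow> complex" where
  "spin2_component M = symmetrize (spin2_tensor M)"

text \<open>The tensor is well defined, and its entries are coefficients in the monomial basis.\<close>

definition spin2_support :: "(4 \<Rightarrow> 2) \<Rightarrow> (4 \<Rightarrow> 2) \<Rightarrow> gen set" where
  "spin2_support I J = (\<Union>A. {Eta A 1 (I A), Eta A 2 (J A)})"

lemma spin2_support_mem [simp]:
  "Eta A i K \<in> spin2_support I J \<longleftrightarrow> K = (if i = 1 then I A else J A)"
  "EtaP A \<notin> spin2_support I J"
  using exhaust_2[of i] by (auto simp: spin2_support_def)

lemma spin2_support_inject [simp]:
  "spin2_support I J = spin2_support I' J' \<longleftrightarrow> I = I' \<and> J = J'"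
proof
  assume eq: "spin2_support I J = spin2_support I' J'"
  have "I A = I' A \<and> J A = J' A" for A
    using eq spin2_support_mem(1)[of A 1 "I A" I J] spin2_support_mem(1)[of A 2 "J A" I J]
      spin2_support_mem(1)[of A 1 "I A" I' J'] spin2_support_mem(1)[of A 2 "J A" I' J'] by simp
  then show "I = I' \<and> J = J'" by auto
qed simp

lemma spin2_degree_iff: "spin2_degree S \<longleftrightarrow> (\<exists>I J. S = spin2_support I J)"
proof
  assume S: "spin2_degree S"
  have "\<exists>K. S \<inter> range (Eta A i) = {Eta A i K}" for A i
  proof -
    have "card (S \<inter> range (Eta A i)) = 1" using S by (simp add: spin2_degree_def)
    then obtain g where g: "S \<inter> range (Eta A i) = {g}" by (auto simp: card_1_singleton_iff)
    then have "g \<in> range (Eta A i)" by blast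
    with g show ?thesis by auto
  qed
  then obtain K where K: "\<And>A i. S \<inter> range (Eta A i) = {Eta A i (K A i)}" by metis
  have P: "S \<inter> range EtaP = {}" using S by (simp add: spin2_degree_def)
  have "S = spin2_support (\<lambda>A. K A 1) (\<lambda>A. K A 2)"
  proof (rule set_eqI)
    fix g
    show "g \<in> S \<longleftrightarrow> g \<in> spin2_support (\<lambda>A. K A 1) (\<lambda>A. K A 2)"
    proof (cases g)
      case (Eta A i L)
      have "Eta A i L \<in> S \<longleftrightarrow> Eta A i L \<in> S \<inter> range (Eta A i)" by blast
      then show ?thesis using Eta K[of A i] exhaust_2[of i] by auto
    next
      case (EtaP A)
      then show ?thesis using P by auto
    qed
  qed
  then show "\<exists>I J. S = spin2_support I J" by blast
next
  assume "\<exists>I J. S = spin2_support I J"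
  then obtain I J where S: "S = spin2_support I J" by blast
  have "S \<inter> range (Eta A i) = {Eta A i (if i = 1 then I A else J A)}" for A i
    by (auto simp: S)
  moreover have "S \<inter> range EtaP = {}" by (auto simp: S)
  ultimately show "spin2_degree S" by (simp add: spin2_degree_def)
qed

lemma spin2_monomial_eq: "spin2_monomial I J = gbasis (spin2_support I J)"
proof -
  define P where "P = (\<lambda>A. {Eta A 1 (I A), Eta A 2 (J A)})"
  have "eta A 1 (I A) * eta A 2 (J A) = gbasis ({Eta A 1 (I A)} \<union> {Eta A 2 (J A)})" for A
    unfolding gvar_def by (rule gbasis_mult_increasing) (simp add: less_gen_def pos2_def)
  then have pair: "eta A 1 (I A) * eta A 2 (J A) = gbasis (P A)" for A
    by (simp add: P_def insert_commute)
  have P: "g < h" if "g \<in> P A" "h \<in> P B" "pos4 A < pos4 B" for g h A B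
    using that by (auto simp: P_def less_gen_def pos2_def)
  have "spin2_monomial I J = gbasis (P 1) * (gbasis (P 2) * (gbasis (P 3) * gbasis (P 4)))"
    by (simp add: spin2_monomial_def pair)
  also have "gbasis (P 3) * gbasis (P 4) = gbasis (P 3 \<union> P 4)"
    by (rule gbasis_mult_increasing) (erule (1) P, simp add: pos4_def)
  also have "gbasis (P 2) * \<dots> = gbasis (P 2 \<union> (P 3 \<union> P 4))"
    by (rule gbasis_mult_increasing) (elim UnE; erule (1) P, simp add: pos4_def)
  also have "gbasis (P 1) * \<dots> = gbasis (P 1 \<union> (P 2 \<union> (P 3 \<union> P 4)))"
    by (rule gbasis_mult_increasing) (elim UnE; erule (1) P, simp add: pos4_def)
  also have "P 1 \<union> (P 2 \<union> (P 3 \<union> P 4)) = spin2_support I J"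
    unfolding spin2_support_def UNIV_4 P_def by auto
  finally show ?thesis .
qed

lemma gcoeff_spin2_sum:
  "gcoeff (\<Sum>I\<in>UNIV. \<Sum>J\<in>UNIV. gconst (C I J) * spin2_monomial I J) (spin2_support I' J') = C I' J'"
proof -
  have "gcoeff (\<Sum>I\<in>UNIV. \<Sum>J\<in>UNIV. gconst (C I J) * spin2_monomial I J) (spin2_support I' J')
      = (\<Sum>I\<in>UNIV. \<Sum>J\<in>UNIV. if J = J' then (if I = I' then C I J' else 0) else 0)"
    unfolding gcoeff_sum by (intro sum.cong refl) (auto simp: spin2_monomial_eq gcoeff_gbasis)
  then show ?thesis by (simp add: sum.delta)
qed

lemma gcoeff_spin2_part:
  "gcoeff (spin2_part M) S = (if spin2_degree S then gcoeff M S else 0)"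
  by (simp add: spin2_part_def)

lemma spin2_degree_support: "spin2_degree (spin2_support I J)"
  unfolding spin2_degree_iff by blast

lemma spin2_tensor_ex1:
  "\<exists>!C. spin2_part M = (\<Sum>I\<in>UNIV. \<Sum>J\<in>UNIV. gconst (C I J) * spin2_monomial I J)"
proof (rule ex1I[of _ "\<lambda>I J. gcoeff M (spin2_support I J)"])
  let ?C = "\<lambda>I J. gcoeff M (spin2_support I J)"
  show "spin2_part M = (\<Sum>I\<in>UNIV. \<Sum>J\<in>UNIV. gconst (?C I J) * spin2_monomial I J)"
    (is "_ = ?R")
  proof (rule grassmann_eqI)
    fix S
    show "gcoeff (spin2_part M) S = gcoeff ?R S"
    proof (cases "spin2_degree S")
      case True
      then obtain I J where S: "S = spin2_support I J" unfolding spin2_degree_iff by blast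
      show ?thesis
        unfolding S gcoeff_spin2_part gcoeff_spin2_sum if_P[OF spin2_degree_support] ..
    next
      case False
      then have "S \<noteq> spin2_support I J" for I J unfolding spin2_degree_iff by blast
      then have "gcoeff ?R S = 0" by (simp add: spin2_monomial_eq gcoeff_gbasis)
      with False show ?thesis unfolding gcoeff_spin2_part by (simp only: if_False)
    qed
  qed
next
  fix C
  assume C: "spin2_part M = (\<Sum>I\<in>UNIV. \<Sum>J\<in>UNIV. gconst (C I J) * spin2_monomial I J)"
  have "C I J = gcoeff M (spin2_support I J)" for I J
  proof -
    have "C I J = gcoeff (spin2_part M) (spin2_support I J)"
      unfolding C gcoeff_spin2_sum ..
    also have "\<dots> = gcoeff M (spin2_support I J)"
      unfolding gcoeff_spin2_part if_P[OF spin2_degree_support] ..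
    finally show ?thesis .
  qed
  then show "C = (\<lambda>I J. gcoeff M (spin2_support I J))" by (intro ext)
qed

lemma spin2_tensor_eq: "spin2_tensor M I J = gcoeff M (spin2_support I J)"
proof -
  have M: "spin2_part M =
      (\<Sum>I\<in>UNIV. \<Sum>J\<in>UNIV. gconst (spin2_tensor M I J) * spin2_monomial I J)"
    unfolding spin2_tensor_def by (rule theI'[OF spin2_tensor_ex1])
  have "gcoeff (spin2_part M) (spin2_support I J) = spin2_tensor M I J"
    by (subst M) (rule gcoeff_spin2_sum)
  then show ?thesis unfolding gcoeff_spin2_part if_P[OF spin2_degree_support] by (rule sym)
qed

end

theory Submission
  imports Defs
begin

text \<open>
  In the required component only the terms of total degree four in the massive \<open>\<eta>\<close> and degree zero
  in \<open>\<eta>\<^sub>P\<close> of each factor matter, and for the pair \<open>(a, b)\<close> they are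
  \<open>Q\<^sup>a Q\<^sup>b - x c s (Q\<^sup>a R\<^sup>b + R\<^sup>a Q\<^sup>b)\<close> with \<open>Q = \<delta> \<H>\<close> and \<open>R\<close> the product of \<open>\<delta>\<close> and the barred \<open>\<H>\<close>.
  The Schouten identity removes the reference spinors: the \<open>\<eta>\<^sub>1 \<eta>\<^sub>2\<close> coefficients of \<open>Q\<close> and \<open>x R\<close> are
  \<open>-\<langle>12\<rangle>\<close> and \<open>-[12]\<close>. Momentum conservation gives \<open>[12] = \<langle>12\<rangle> + \<langle>1|P|2]/m\<close>, and symmetrization lets
  one collect the powers of \<open>\<langle>12\<rangle>\<close> and \<open>\<langle>1|P|2]\<close>, with \<open>2 c s = Z/(2m)\<close>.
\<close>

section \<open>Supports and degrees in the Grassmann algebra\<close>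

text \<open>Membership in the subalgebra generated by \<open>V\<close>, expressed through
  coefficients.\<close>

definition supported :: "'g set \<Rightarrow> 'g grassmann \<Rightarrow> bool" where
  "supported V f \<longleftrightarrow> (\<forall>S. gcoeff f S \<noteq> 0 \<longrightarrow> S \<subseteq> V)"

text \<open>The grading in which the generator \<open>g\<close> has weight \<open>w g\<close>; zero
  is homogeneous of every weight.\<close>

definition homogeneous :: "('g \<Rightarrow> nat) \<Rightarrow> nat \<Rightarrow> 'g::{finite,linorder} grassmann \<Rightarrow> bool" where
  "homogeneous w n f \<longleftrightarrow> (\<forall>S. gcoeff f S \<noteq> 0 \<longrightarrow> sum w S = n)"

lemma gcoeff_mult_nonzeroE:
  fixes f g :: "'g::{finite,linorder} grassmann"
  assumes "gcoeff (f * g) U \<noteq> 0"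
  obtains S where "S \<subseteq> U" "gcoeff f S \<noteq> 0" "gcoeff g (U - S) \<noteq> 0"
proof -
  obtain S where "S \<in> Pow U" "gsign S (U - S) * gcoeff f S * gcoeff g (U - S) \<noteq> 0"
    using assms unfolding gcoeff_mult by (meson sum.not_neutral_contains_not_neutral)
  then show thesis using that by auto
qed

lemma supported_arith:
  fixes f g :: "'g::{finite,linorder} grassmann"
  assumes "supported V f" "supported V g"
  shows "supported V (f + g)" "supported V (f - g)"
  using assms unfolding supported_def gcoeff_simps
  by (metis add_0, metis diff_0_right)

lemma supported_uminus:
  fixes f :: "'g::{finite,linorder} grassmann"
  shows "supported V f \<Longrightarrow> supported V (- f)"
  by (simp add: supported_def)

lemma supported_mult:
  fixes f g :: "'g::{finite,linorder} grassmann"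
  assumes "supported V f" "supported V g"
  shows "supported V (f * g)"
  unfolding supported_def
proof (intro allI impI)
  fix U assume "gcoeff (f * g) U \<noteq> 0"
  then obtain S where "S \<subseteq> U" "gcoeff f S \<noteq> 0" "gcoeff g (U - S) \<noteq> 0"
    by (rule gcoeff_mult_nonzeroE)
  with assms show "U \<subseteq> V" unfolding supported_def by blast
qed

lemma supported_gconst: "supported V (gconst c)"
  by (simp add: supported_def gconst_def)

lemma supported_gvar: "g \<in> V \<Longrightarrow> supported V (gvar g)"
  by (simp add: supported_def gvar_def gcoeff_gbasis)

lemma supported_mono: "supported V f \<Longrightarrow> V \<subseteq> W \<Longrightarrow> supported W f"
  unfolding supported_def by blast

lemma homogeneous_mult:
  fixes f g :: "'g::{finite,linorder} grassmann"
  assumes "homogeneous w n f" "homogeneous w k g"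
  shows "homogeneous w (n + k) (f * g)"
  unfolding homogeneous_def
proof (intro allI impI)
  fix U assume "gcoeff (f * g) U \<noteq> 0"
  then obtain S where S: "S \<subseteq> U" "gcoeff f S \<noteq> 0" "gcoeff g (U - S) \<noteq> 0"
    by (rule gcoeff_mult_nonzeroE)
  then have "sum w U = sum w (U - S) + sum w S" by (intro sum.subset_diff) auto
  with S assms show "sum w U = n + k" unfolding homogeneous_def by simp
qed

lemma homogeneous_gconst: "homogeneous w 0 (gconst c)"
  by (simp add: homogeneous_def gconst_def)

lemma homogeneous_gvar: "homogeneous w (w g) (gvar g)"
  by (simp add: homogeneous_def gvar_def gcoeff_gbasis)

lemma homogeneous_uminus: "homogeneous w n f \<Longrightarrow> homogeneous w n (- f)"
  by (simp add: homogeneous_def)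

lemma homogeneous_add: "homogeneous w n f \<Longrightarrow> homogeneous w n g \<Longrightarrow> homogeneous w n (f + g)"
  unfolding homogeneous_def gcoeff_simps by (metis add_0)

lemma gcoeff_homogeneous_eq_0: "homogeneous w n f \<Longrightarrow> sum w U \<noteq> n \<Longrightarrow> gcoeff f U = 0"
  unfolding homogeneous_def by blast

text \<open>A part \<open>R\<close> of \<open>S \<union> T\<close> contributes only if
  \<open>R\<close> lies in \<open>V\<close> and its complement in \<open>W\<close>; as
  \<open>T\<close> misses \<open>V\<close> and \<open>S\<close> misses \<open>W\<close>, this forces
  \<open>R = S\<close>, with sign \<open>1\<close> by the ordering. Since \<open>V\<close> and
  \<open>W\<close> may overlap, both factors may contain the \<open>EtaP\<close> generators.\<close>

lemma gcoeff_mult_supported: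
  fixes f g :: "'g::{finite,linorder} grassmann"
  assumes f: "supported V f" and g: "supported W g"
    and ST: "S \<inter> W = {}" "T \<inter> V = {}" "\<And>s t. s \<in> S \<Longrightarrow> t \<in> T \<Longrightarrow> s < t"
  shows "gcoeff (f * g) (S \<union> T) = gcoeff f S * gcoeff g T"
proof -
  have disj: "S \<inter> T = {}" using ST(3) by blast
  have "{(s, t). s \<in> S \<and> t \<in> T \<and> t < s} = {}" using ST(3) by (auto dest: less_asym)
  then have sgn: "gsign S T = 1" by (simp only: gsign_def) simp
  have "gsign R (S \<union> T - R) * gcoeff f R * gcoeff g (S \<union> T - R)
      = (if R = S then gcoeff f S * gcoeff g T else 0)" if "R \<in> Pow (S \<union> T)" for R
  proof (cases "R = S")
    case True
    have "S \<union> T - S = T" using disj by blast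
    with True show ?thesis by (simp add: sgn)
  next
    case False
    have "\<not> (R \<subseteq> V \<and> S \<union> T - R \<subseteq> W)"
      using False that ST(1,2) disj by blast
    then have "gcoeff f R = 0 \<or> gcoeff g (S \<union> T - R) = 0"
      using f g unfolding supported_def by blast
    with False show ?thesis by auto
  qed
  then have "gcoeff (f * g) (S \<union> T)
      = (\<Sum>R\<in>Pow (S \<union> T). if R = S then gcoeff f S * gcoeff g T else 0)"
    unfolding gcoeff_mult by (rule sum.cong[OF refl])
  then show ?thesis by simp
qed

lemma gconst_central:
  fixes f :: "'g::{finite,linorder} grassmann"
  shows "f * gconst c = gconst c * f"
  by (rule grassmann_eqI) simp

lemma gconst_mult_gconst:
  "gconst c * gconst d = (gconst (c * d) :: 'g::{finite,linorder} grassmann)"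
  by (rule grassmann_eqI) (simp, simp add: gconst_def)

lemma gconst_mult_mult:
  fixes f g :: "'g::{finite,linorder} grassmann"
  shows "gconst c * f * (gconst d * g) = gconst (c * d) * (f * g)"
proof -
  have "gconst c * f * (gconst d * g) = gconst c * (f * gconst d) * g"
    by (simp only: mult.assoc)
  also have "\<dots> = gconst c * gconst d * (f * g)"
    by (simp only: gconst_central[of f d] mult.assoc)
  finally show ?thesis by (simp only: gconst_mult_gconst)
qed

section \<open>Linear forms in the massive generators\<close>

text \<open>Common shape of \<delta>, \<H> and the barred \<H>, so that the pair factors can be
  expanded for arbitrary coefficients before any kinematics enters.\<close>

definition linform :: "(2 \<Rightarrow> 2 \<Rightarrow> complex) \<Rightarrow> 4 \<Rightarrow> gen grassmann" where
  "linform c A = (\<Sum>i\<in>UNIV. \<Sum>K\<in>UNIV. gconst (c i K) * eta A i K)"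

lemma gconst_mult_linform: "gconst d * linform c A = linform (\<lambda>i K. d * c i K) A"
  by (simp add: linform_def sum_distrib_left mult.assoc[symmetric] gconst_mult_gconst)

lemma supported_linform: "supported (range (\<lambda>(i, K). Eta A i K)) (linform c A)"
  unfolding linform_def sum_2
  by (intro supported_arith supported_mult supported_gconst supported_gvar) auto

lemma homogeneous_linform:
  fixes w :: "gen \<Rightarrow> nat"
  assumes "\<And>i K. w (Eta A i K) = n"
  shows "homogeneous w n (linform c A)"
proof -
  have "homogeneous w n (gconst (c i K) * eta A i K)" for i K
    using homogeneous_mult[OF homogeneous_gconst[of w "c i K"] homogeneous_gvar[of w "Eta A i K"]]
    by (simp add: assms)
  then show ?thesis unfolding linform_def sum_2 by (intro homogeneous_add)
qed

text \<open>Anticommutation of generators passes through one sum at a time, first those of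
  \<open>d\<close>, then those of \<open>c\<close>.\<close>

lemma linform_anticommute: "linform c A * linform d B = - (linform d B * linform c A)"
proof -
  have anti: "gconst p * gvar g * (gconst q * gvar h) = - (gconst q * gvar h * (gconst p * gvar g))"
    for p q and g h :: gen
    by (simp add: gconst_mult_mult gvar_anticommute[of g h] mult.commute)
  have sum_anti: "sum f S * y = - (y * sum f S)" if "\<And>i. f i * y = - (y * f i)"
    for f :: "2 \<Rightarrow> gen grassmann" and S y
    by (simp only: sum_distrib_left sum_distrib_right that sum_negf)
  have "linform d B * (gconst (c i K) * eta A i K) = - (gconst (c i K) * eta A i K * linform d B)"
    for i K
    unfolding linform_def by (intro sum_anti anti)
  then have "gconst (c i K) * eta A i K * linform d B = - (linform d B * (gconst (c i K) * eta A i K))"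
    for i K
    by (metis minus_minus)
  then show ?thesis
    unfolding linform_def[of c A] by (intro sum_anti)
qed

lemma gcoeff_linform: "gcoeff (linform c A) {Eta A i K} = c i K"
proof -
  have "gcoeff (linform c A) {Eta A i K}
      = (\<Sum>j\<in>UNIV. \<Sum>L\<in>UNIV. if L = K then (if j = i then c j K else 0) else 0)"
    unfolding linform_def gcoeff_sum by (intro sum.cong refl) (auto simp: gvar_def gcoeff_gbasis)
  then show ?thesis by simp
qed

text \<open>Linear forms have no constant term, so each factor supplies exactly one of the two
  generators; the minus sign comes from moving \<open>Eta A 2 L\<close> past
  \<open>Eta A 1 K\<close>.\<close>

lemma gcoeff_linform_mult:
  "gcoeff (linform c A * linform d A) {Eta A 1 K, Eta A 2 L} = c 1 K * d 2 L - c 2 L * d 1 K"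
proof -
  let ?g = "Eta A 1 K" and ?h = "Eta A 2 L"
  have lt: "?g < ?h" "\<not> ?h < ?g" by (simp_all add: less_gen_def pos2_def)
  have z: "gcoeff (linform b A) {} = 0" for b
    by (simp add: linform_def gvar_def gcoeff_gbasis)
  have "Pow {?g, ?h} = {{}, {?g}, {?h}, {?g, ?h}}" by auto
  moreover have "{?g, ?h} - {?g} = {?h}" "{?g, ?h} - {?h} = {?g}" by auto
  ultimately show ?thesis
    by (simp add: gcoeff_mult z gcoeff_linform gsign_singleton lt doubleton_eq_iff)
qed

section \<open>The factor of an R-symmetry pair\<close>

definition pair_support :: "4 \<Rightarrow> 4 \<Rightarrow> (4 \<Rightarrow> 2) \<Rightarrow> (4 \<Rightarrow> 2) \<Rightarrow> gen set" where
  "pair_support a b I J = {Eta a 1 (I a), Eta a 2 (J a)} \<union> {Eta b 1 (I b), Eta b 2 (J b)}"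

text \<open>The two quadratic products involve different R-symmetry indices, so the coefficient
  factorizes into two minors; \<open>pos4 a < pos4 b\<close> puts the generators of \<open>a\<close>
  first.\<close>

lemma gcoeff_linform_quartic:
  assumes "pos4 a < pos4 b"
  shows "gcoeff (linform p a * linform q a * (linform r b * linform t b)) (pair_support a b I J)
    = (p 1 (I a) * q 2 (J a) - p 2 (J a) * q 1 (I a))
    * (r 1 (I b) * t 2 (J b) - r 2 (J b) * t 1 (I b))"
proof -
  have "a \<noteq> b" using assms by auto
  then show ?thesis
    unfolding pair_support_def
    by (subst gcoeff_mult_supported[OF supported_mult[OF supported_linform supported_linform]
          supported_mult[OF supported_linform supported_linform]])
      (use assms in \<open>auto simp: gcoeff_linform_mult less_gen_def pos2_def\<close>)
qed

text \<open>Any weight above the degree four of the component singles out the terms free of \<open>\<eta>\<^sub>P\<close>.\<close>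

fun gen_weight :: "gen \<Rightarrow> nat" where
  "gen_weight (Eta A i K) = 1"
| "gen_weight (EtaP A) = 5"

lemma sum_gen_weight_pair_support:
  assumes "a \<noteq> b"
  shows "sum gen_weight (pair_support a b I J) = 4"
  unfolding pair_support_def using assms by (subst sum.union_disjoint) auto

lemma gcoeff_weight_eq_0:
  assumes "homogeneous gen_weight n f" "a \<noteq> b" "n \<noteq> 4"
  shows "gcoeff f (pair_support a b I J) = 0"
  by (rule gcoeff_homogeneous_eq_0[OF assms(1)])
    (simp add: sum_gen_weight_pair_support[OF assms(2)] assms(3)[symmetric])

lemmas homogeneous_gen_weight =
  homogeneous_linform[of gen_weight _ 1, OF gen_weight.simps(1)]
  homogeneous_gvar[of gen_weight "EtaP _", unfolded gen_weight.simps]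
  homogeneous_gconst[of gen_weight]

text \<open>The weights are those of the four terms in each factor of \<open>S1\<close>, with 1 for
  a linear form and 5 for each \<open>EtaP\<close>. Only \<open>2 + 2\<close> gives the weight 4 of
  the pair support, and the two minus signs cancel.\<close>

lemma gcoeff_S1_factors:
  assumes "homogeneous gen_weight 6 p" "homogeneous gen_weight 2 q"
    and "homogeneous gen_weight 12 r" "homogeneous gen_weight 8 t"
    and "homogeneous gen_weight 6 p'" "homogeneous gen_weight 2 q'"
    and "homogeneous gen_weight 12 r'" "homogeneous gen_weight 8 t'"
    and "a \<noteq> b"
  shows "gcoeff ((p - q - r + t) * (p' - q' + r' + t')) (pair_support a b I J)
    = gcoeff (q * q') (pair_support a b I J)"
proof -
  have z: "gcoeff (f * g) (pair_support a b I J) = 0"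
    if "homogeneous gen_weight n f" "homogeneous gen_weight k g" "n + k \<noteq> 4" for f g n k
    using gcoeff_weight_eq_0[OF homogeneous_mult[OF that(1,2)] assms(9) that(3)] .
  note z' = z[OF assms(1)] z[OF assms(2)] z[OF assms(3)] z[OF assms(4)]
  show ?thesis
    by (simp add: distrib_left distrib_right left_diff_distrib right_diff_distrib
        z'[OF assms(5)] z'[OF assms(6)] z'[OF assms(7)] z'[OF assms(8)])
qed

text \<open>As for \<open>S1\<close>, but weight 4 now arises as \<open>3 + 1\<close> and as
  \<open>1 + 3\<close>: the cosine term of one factor meets the sine term of the other.\<close>

lemma gcoeff_S2_factors:
  assumes "homogeneous gen_weight 3 p" "homogeneous gen_weight 7 q" "homogeneous gen_weight 1 r"
    and "homogeneous gen_weight 3 p'" "homogeneous gen_weight 7 q'" "homogeneous gen_weight 1 r'"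
    and "a \<noteq> b"
  shows "gcoeff ((p + q + r) * (p' + q' + r')) (pair_support a b I J)
    = gcoeff (p * r') (pair_support a b I J) + gcoeff (r * p') (pair_support a b I J)"
proof -
  have z: "gcoeff (f * g) (pair_support a b I J) = 0"
    if "homogeneous gen_weight n f" "homogeneous gen_weight k g" "n + k \<noteq> 4" for f g n k
    using gcoeff_weight_eq_0[OF homogeneous_mult[OF that(1,2)] assms(7) that(3)] .
  note z' = z[OF assms(1)] z[OF assms(2)] z[OF assms(3)]
  show ?thesis
    by (simp add: distrib_left distrib_right
        z'[OF assms(4)] z'[OF assms(5)] z'[OF assms(6)])
qed

lemma gcoeff_S1:
  assumes "pos4 a < pos4 b"
  shows "gcoeff (S1 \<theta> (linform d) (linform h) (linform g) a b) (pair_support a b I J)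
    = (d 1 (I a) * h 2 (J a) - d 2 (J a) * h 1 (I a))
    * (d 1 (I b) * h 2 (J b) - d 2 (J b) * h 1 (I b))"
proof -
  note hm = homogeneous_mult and lin = homogeneous_gen_weight(1)
    and eP = homogeneous_gen_weight(2) and co = homogeneous_gen_weight(3)
  have "a \<noteq> b" using assms by auto
  then have "gcoeff (S1 \<theta> (linform d) (linform h) (linform g) a b) (pair_support a b I J)
      = gcoeff (linform d a * linform h a * (linform d b * linform h b)) (pair_support a b I J)"
    \<comment> \<open>The supplied facts compute the weight of each term; the variants with
      \<open>homogeneous_uminus\<close> serve the lowered component \<open>- Hb b\<close> in the
      second factor.\<close>
    unfolding S1_def Let_def
    by (intro gcoeff_S1_factors)
      (use hm[OF hm[OF co eP] lin] hm[OF lin lin]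
        hm[OF hm[OF hm[OF hm[OF hm[OF co co] lin] lin] eP] eP]
        hm[OF hm[OF hm[OF hm[OF hm[OF co co] lin] homogeneous_uminus[OF lin]] eP] eP]
        hm[OF hm[OF hm[OF hm[OF co lin] lin] lin] eP]
        hm[OF hm[OF hm[OF hm[OF co lin] lin] homogeneous_uminus[OF lin]] eP] in
          \<open>simp_all add: numeral_2_eq_2\<close>)
  then show ?thesis by (simp only: gcoeff_linform_quartic[OF assms])
qed

lemma gcoeff_S2:
  assumes "pos4 a < pos4 b"
  shows "gcoeff (S2 x \<theta> (linform d) (linform h) (linform g) a b) (pair_support a b I J)
    = - x * (cos \<theta> * sin \<theta>) *
     ((d 1 (I a) * h 2 (J a) - d 2 (J a) * h 1 (I a))
      * (d 1 (I b) * g 2 (J b) - d 2 (J b) * g 1 (I b))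
    + (d 1 (I a) * g 2 (J a) - d 2 (J a) * g 1 (I a))
      * (d 1 (I b) * h 2 (J b) - d 2 (J b) * h 1 (I b)))"
proof -
  note hm = homogeneous_mult and lin = homogeneous_gen_weight(1)
    and eP = homogeneous_gen_weight(2) and co = homogeneous_gen_weight(3)
  define c s where "c = complex_of_real (cos \<theta>)" and "s = complex_of_real (sin \<theta>)"
  define D H G where "D = linform d" and "H = linform h" and "G = linform g"
  let ?U = "pair_support a b I J"
  have ab: "a \<noteq> b" using assms by auto
  \<comment> \<open>The minus sign of the lowered component is absorbed by moving \<open>G b\<close>
    past \<open>D b\<close>, which leaves a product of a form in \<open>a\<close> and a form in
    \<open>b\<close>.\<close>
  have "gconst c * D a * H a * (- G b) * (gconst s * D b)
      = gconst c * (D a * H a) * (gconst s * - (G b * D b))"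
    by (simp add: mult.assoc) (metis gconst_central mult.assoc)
  also have "\<dots> = gconst (c * s) * (D a * H a * - (G b * D b))"
    by (rule gconst_mult_mult)
  also have "- (G b * D b) = D b * G b"
    unfolding D_def G_def by (subst linform_anticommute) simp
  finally have 1: "gconst c * D a * H a * (- G b) * (gconst s * D b)
      = gconst (c * s) * (D a * H a * (D b * G b))" .
  \<comment> \<open>The odd element \<open>G a\<close> passes the even product
    \<open>D b * H b\<close> without a sign, so it can join \<open>D a\<close>.\<close>
  have "D b * H b * G a = G a * (D b * H b)"
    unfolding D_def H_def G_def
    by (metis linform_anticommute minus_mult_left minus_mult_right minus_minus mult.assoc)
  then have "gconst s * D a * (gconst c * D b * H b * G a)
      = gconst s * D a * (gconst c * (G a * (D b * H b)))"
    by (simp only: mult.assoc)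
  also have "\<dots> = gconst (s * c) * (D a * (G a * (D b * H b)))"
    by (rule gconst_mult_mult)
  finally have 2: "gconst s * D a * (gconst c * D b * H b * G a)
      = gconst (c * s) * (D a * G a * (D b * H b))"
    by (simp only: mult.assoc mult.commute[of s c])
  have "gcoeff (S2 x \<theta> D H G a b) ?U = - x * gcoeff
      ((gconst c * D a * H a * (- G b) + D a * etaP a * (- G b) + gconst s * D a)
      * (gconst c * D b * H b * G a + D b * etaP b * G a + gconst s * D b)) ?U"
    unfolding S2_def Let_def c_def s_def
    by (simp only: mult.assoc minus_mult_left[symmetric] gcoeff_simps gcoeff_gconst_mult mult_minus_left)
  also have "gcoeff
      ((gconst c * D a * H a * (- G b) + D a * etaP a * (- G b) + gconst s * D a)
      * (gconst c * D b * H b * G a + D b * etaP b * G a + gconst s * D b)) ?U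
    = gcoeff (gconst c * D a * H a * (- G b) * (gconst s * D b)) ?U
      + gcoeff (gconst s * D a * (gconst c * D b * H b * G a)) ?U"
    unfolding D_def H_def G_def
    by (intro gcoeff_S2_factors)
      (use hm[OF hm[OF hm[OF co lin] lin] lin] hm[OF co lin]
        hm[OF hm[OF hm[OF co lin] lin] homogeneous_uminus[OF lin]]
        hm[OF hm[OF lin eP] lin] hm[OF hm[OF lin eP] homogeneous_uminus[OF lin]] ab in
          \<open>simp_all add: numeral_3_eq_3\<close>)
  also have "\<dots> = c * s * (gcoeff (D a * H a * (D b * G b)) ?U + gcoeff (D a * G a * (D b * H b)) ?U)"
    unfolding 1 2 by (simp add: distrib_left)
  finally show ?thesis
    unfolding D_def H_def G_def gcoeff_linform_quartic[OF assms] c_def s_def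
    by (simp only: mult.assoc of_real_mult)
qed

text \<open>Both pairs receive every \<open>EtaP\<close>; the overlap is harmless in
  \<open>gcoeff_mult_supported\<close>, since a pair support contains massive generators
  only.\<close>

definition pair_gens :: "4 \<Rightarrow> 4 \<Rightarrow> gen set" where
  "pair_gens a b = {Eta A i K | A i K. A = a \<or> A = b} \<union> range EtaP"

lemma supported_S1_S2:
  "supported (pair_gens a b) (S1 \<theta> (linform d) (linform h) (linform g) a b
    + S2 x \<theta> (linform d) (linform h) (linform g) a b)"
proof -
  have lin: "supported (pair_gens a b) (linform f a)" "supported (pair_gens a b) (linform f b)" for f
    by (rule supported_mono[OF supported_linform], force simp: pair_gens_def)+
  have P: "supported (pair_gens a b) (etaP A)" for A
    by (rule supported_gvar) (simp add: pair_gens_def)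
  show ?thesis
    unfolding S1_def S2_def Let_def
    by (intro supported_arith supported_uminus supported_mult lin P supported_gconst)
qed

lemma spin2_tensor_superamplitude:
  fixes d h g :: "2 \<Rightarrow> 2 \<Rightarrow> complex"
  defines "Q \<equiv> \<lambda>K L. d 1 K * h 2 L - d 2 L * h 1 K"
    and "R \<equiv> \<lambda>K L. d 1 K * g 2 L - d 2 L * g 1 K"
  shows "spin2_tensor (superamplitude e m x \<theta>12 \<theta>34 (linform d) (linform h) (linform g)) I J
    = e / complex_of_real m ^ 3 * x
      * (Q (I 1) (J 1) * Q (I 2) (J 2) - x * (cos \<theta>12 * sin \<theta>12) *
          (Q (I 1) (J 1) * R (I 2) (J 2) + R (I 1) (J 1) * Q (I 2) (J 2)))
      * (Q (I 3) (J 3) * Q (I 4) (J 4) - x * (cos \<theta>34 * sin \<theta>34) *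
          (Q (I 3) (J 3) * R (I 4) (J 4) + R (I 3) (J 3) * Q (I 4) (J 4)))"
proof -
  let ?F = "\<lambda>\<theta> a b. S1 \<theta> (linform d) (linform h) (linform g) a b
    + S2 x \<theta> (linform d) (linform h) (linform g) a b"
  have F: "gcoeff (?F \<theta> a b) (pair_support a b I J) = Q (I a) (J a) * Q (I b) (J b)
      - x * (cos \<theta> * sin \<theta>) * (Q (I a) (J a) * R (I b) (J b) + R (I a) (J a) * Q (I b) (J b))"
    if "pos4 a < pos4 b" for \<theta> a b
    unfolding gcoeff_simps gcoeff_S1[OF that] gcoeff_S2[OF that] Q_def R_def by simp
  have U: "spin2_support I J = pair_support 1 2 I J \<union> pair_support 3 4 I J"
    unfolding spin2_support_def pair_support_def UNIV_4 by auto
  have "gcoeff (?F \<theta>12 1 2 * ?F \<theta>34 3 4) (spin2_support I J)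
      = gcoeff (?F \<theta>12 1 2) (pair_support 1 2 I J) * gcoeff (?F \<theta>34 3 4) (pair_support 3 4 I J)"
    unfolding U
    by (rule gcoeff_mult_supported[OF supported_S1_S2 supported_S1_S2])
      (auto simp: pair_support_def pair_gens_def less_gen_def pos2_def pos4_def)
  moreover have "pos4 1 < pos4 2" "pos4 3 < pos4 4" by (simp_all add: pos4_def)
  ultimately show ?thesis
    unfolding spin2_tensor_eq superamplitude_def mult.assoc gcoeff_gconst_mult
    by (simp only: F mult.assoc)
qed

section \<open>Kinematics\<close>

lemma angle_br_eq: "angle_br u v = u $ 2 * v $ 1 - u $ 1 * v $ 2"
  by (simp add: angle_br_def raise_index_def eps_up_def sum_2)

lemma square_br_eq: "square_br u v = u $ 1 * v $ 2 - u $ 2 * v $ 1"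
  by (simp add: square_br_def raise_index_def eps_up_def sum_2)

lemma angle_br_skew: "angle_br u v = - angle_br v u"
  by (simp add: angle_br_eq)

lemma angle_br_add_right: "angle_br u (v + w) = angle_br u v + angle_br u w"
  by (simp add: angle_br_eq algebra_simps)

lemma angle_br_scale_right: "angle_br u (c *s v) = c * angle_br u v"
  by (simp add: angle_br_eq algebra_simps)

text \<open>Schouten identity: three vectors in a two-dimensional space are dependent. Dividing by
  \<open>angle_br z p\<close> will remove the reference spinor \<open>z\<close>.\<close>

lemma angle_br_schouten:
  "angle_br p u * angle_br z v - angle_br p v * angle_br z u = - (angle_br z p * angle_br u v)"
  by (simp add: angle_br_eq algebra_simps)

lemma square_br_schouten:
  "square_br u p * square_br z v - square_br v p * square_br z u = square_br z p * square_br u v"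
  by (simp add: square_br_eq algebra_simps)

lemma massless_momentum_mult:
  "massless_momentum p q *v raise_index v = square_br q v *s p"
  by (simp add: vec_eq_iff massless_momentum_def matrix_vector_mult_def square_br_def
      sum_2 algebra_simps)

lemma angle_br_massive_momentum:
  "angle_br u (massive_momentum l lt *v raise_index v)
    = angle_br u (l 2) * square_br (lt 1) v - angle_br u (l 1) * square_br (lt 2) v"
  by (simp add: massive_momentum_def matrix_vector_mult_def square_br_def angle_br_eq
      sum_2 eps_dn_def algebra_simps)

text \<open>The massive Weyl equation: a momentum turns its own spinor into the one of opposite
  chirality, times the mass up to sign.\<close>

lemma angle_br_massive_momentum_left:
  assumes "\<And>K L. angle_br (l K) (l L) = - c * eps_up K L"
  shows "angle_br (l K) (massive_momentum l lt *v raise_index v) = - c * square_br (lt K) v"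
  using exhaust_2[of K]
  by (elim disjE) (simp_all add: angle_br_massive_momentum assms eps_up_def)

lemma angle_br_massive_momentum_right:
  assumes "\<And>K L. square_br (lt K) (lt L) = c * eps_up K L"
  shows "angle_br u (massive_momentum l lt *v raise_index (lt L)) = c * angle_br u (l L)"
  using exhaust_2[of L]
  by (elim disjE) (simp_all add: angle_br_massive_momentum assms eps_up_def)

section \<open>Symmetrization\<close>

lemma symmetrize_add:
  "symmetrize (\<lambda>I J. F I J + G I J) I J = symmetrize F I J + symmetrize G I J"
  by (simp add: symmetrize_def sum.distrib add_divide_distrib)

lemma symmetrize_scale: "symmetrize (\<lambda>I J. c * F I J) I J = c * symmetrize F I J"
  by (simp add: symmetrize_def sum_distrib_left)

text \<open>Right composition with \<open>\<tau>\<close> permutes the index set of both sums. This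
  allows relabelling the four R-symmetry slots.\<close>

lemma symmetrize_compose:
  assumes "\<tau> permutes UNIV"
  shows "symmetrize (\<lambda>I J. F (I \<circ> \<tau>) (J \<circ> \<tau>)) I J = symmetrize F I J"
proof -
  have "(\<Sum>\<pi> | \<pi> permutes UNIV. \<Sum>\<rho> | \<rho> permutes UNIV. F (I \<circ> \<pi>) (J \<circ> \<rho>))
      = (\<Sum>\<pi> | \<pi> permutes UNIV. \<Sum>\<rho> | \<rho> permutes UNIV. F (I \<circ> (\<pi> \<circ> \<tau>)) (J \<circ> (\<rho> \<circ> \<tau>)))"
    by (subst sum_permutations_compose_right[OF assms], rule sum.cong[OF refl],
        subst sum_permutations_compose_right[OF assms], rule refl)
  then show ?thesis by (simp add: symmetrize_def o_assoc)
qed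

lemma symmetrize_transpose:
  "symmetrize (\<lambda>I J. F (I \<circ> Transposition.transpose a b) (J \<circ> Transposition.transpose a b)) I J
    = symmetrize F I J"
  by (rule symmetrize_compose) (rule permutes_swap_id, simp_all)

text \<open>Each factor is \<open>(1 - 2 * q) * A * A - q * (A * B + B * A)\<close>. After
  symmetrization only the number of \<open>B\<close> counts: the single-\<open>B\<close> terms add
  up to \<open>- 2 * r * (1 - 2 * q) - 2 * q * (1 - 2 * r)\<close>, the four double-\<open>B\<close>
  terms to \<open>4 * q * r\<close>.\<close>

lemma symmetrize_pair_factors:
  fixes A B :: "2 \<Rightarrow> 2 \<Rightarrow> complex" and q r :: complex
  defines "F \<equiv> \<lambda>q a b (I :: 4 \<Rightarrow> 2) (J :: 4 \<Rightarrow> 2). A (I a) (J a) * A (I b) (J b)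
      - q * (A (I a) (J a) * (A (I b) (J b) + B (I b) (J b))
           + (A (I a) (J a) + B (I a) (J a)) * A (I b) (J b))"
  shows "symmetrize (\<lambda>I J. k * F q 1 2 I J * F r 3 4 I J) I J
    = k * ((1 - 2 * q) * (1 - 2 * r) * symmetrize (\<lambda>I J. \<Prod>k\<in>{1, 2, 3, 4}. A (I k) (J k)) I J
      + (8 * q * r - 2 * q - 2 * r)
        * symmetrize (\<lambda>I J. (\<Prod>k\<in>{1, 2, 3}. A (I k) (J k)) * (\<Prod>k\<in>{4}. B (I k) (J k))) I J
      + 4 * q * r
        * symmetrize (\<lambda>I J. (\<Prod>k\<in>{1, 2}. A (I k) (J k)) * (\<Prod>k\<in>{3, 4}. B (I k) (J k))) I J)"
proof -
  define F0 F1 F2 where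
    "F0 = (\<lambda>(I :: 4 \<Rightarrow> 2) (J :: 4 \<Rightarrow> 2). \<Prod>k\<in>{1, 2, 3, 4}. A (I k) (J k))" and
    "F1 = (\<lambda>(I :: 4 \<Rightarrow> 2) (J :: 4 \<Rightarrow> 2). (\<Prod>k\<in>{1, 2, 3}. A (I k) (J k)) * (\<Prod>k\<in>{4}. B (I k) (J k)))" and
    "F2 = (\<lambda>(I :: 4 \<Rightarrow> 2) (J :: 4 \<Rightarrow> 2). (\<Prod>k\<in>{1, 2}. A (I k) (J k)) * (\<Prod>k\<in>{3, 4}. B (I k) (J k)))"
  define T where "T = (\<lambda>(a :: 4) b (G :: (4 \<Rightarrow> 2) \<Rightarrow> (4 \<Rightarrow> 2) \<Rightarrow> complex) I J.
    G (I \<circ> Transposition.transpose a b) (J \<circ> Transposition.transpose a b))"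
  have T: "symmetrize (\<lambda>I J. T a b G I J) I J = symmetrize G I J" for a b G
    unfolding T_def by (rule symmetrize_transpose)
  \<comment> \<open>The transpositions move \<open>B\<close> from slot 4, or from slots 3 and 4, to
    where it stands. \<open>F2\<close> never appears untransposed because each pair factor
    contributes at most one \<open>B\<close>.\<close>
  have "k * F q 1 2 I J * F r 3 4 I J
      = k * ((1 - 2 * q) * (1 - 2 * r)) * F0 I J
        + (- (k * ((1 - 2 * q) * r))) * F1 I J + (- (k * ((1 - 2 * q) * r))) * T 3 4 F1 I J
        + (- (k * ((1 - 2 * r) * q))) * T 2 4 F1 I J + (- (k * ((1 - 2 * r) * q))) * T 1 4 F1 I J
        + k * (q * r) * T 2 3 F2 I J + k * (q * r) * T 2 4 F2 I J
        + k * (q * r) * T 1 3 F2 I J + k * (q * r) * T 1 4 F2 I J" for I J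
    unfolding F_def F0_def F1_def F2_def T_def
    by (simp add: Transposition.transpose_def algebra_simps)
  then show ?thesis
    unfolding F0_def[symmetric] F1_def[symmetric] F2_def[symmetric]
    by (simp only: symmetrize_add symmetrize_scale T) (simp add: algebra_simps)
qed

theorem mainTheorem3:
  fixes m Z12 Z34 \<theta>12 \<theta>34 :: real
    and e x :: complex
    and l lt :: "2 \<Rightarrow> 2 \<Rightarrow> spinor"
    and lP ltP \<zeta> \<xi> :: spinor
    and I J :: "4 \<Rightarrow> 2"
  assumes "m > 0"
    and "\<And>i K L. angle_br (l i K) (l i L) = - complex_of_real m * eps_up K L"
    and "\<And>i K L. square_br (lt i K) (lt i L) = complex_of_real m * eps_up K L"
    and "lP \<noteq> 0" and "ltP \<noteq> 0"
    and "massive_momentum (l 1) (lt 1) + massive_momentum (l 2) (lt 2)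
          + massless_momentum lP ltP = 0"
    and "x \<noteq> 0"
    and "x *s lP = (1 / complex_of_real m) *s (massive_momentum (l 1) (lt 1) *v raise_index ltP)"
    and "angle_br \<zeta> lP \<noteq> 0" and "square_br \<xi> ltP \<noteq> 0"
    and "\<bar>Z12\<bar> < 2 * m" and "\<bar>Z34\<bar> < 2 * m"
    and "- (pi / 4) < \<theta>12" and "\<theta>12 < pi / 4" and "- (pi / 4) < \<theta>34" and "\<theta>34 < pi / 4"
    and "sin (2 * \<theta>12) = Z12 / (2 * m)" and "sin (2 * \<theta>34) = Z34 / (2 * m)"
  shows "spin2_component
      (superamplitude e m x \<theta>12 \<theta>34
        (supercharge_delta l lP) (calH l lP \<zeta>) (calH_bar lt ltP \<xi>)) I J
    = e / complex_of_real m ^ 3 *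
      (complex_of_real ((1 - Z12 / (2 * m)) * (1 - Z34 / (2 * m))) * x *
        symmetrize (\<lambda>I J. \<Prod>k\<in>{1, 2, 3, 4}. angle_br (l 1 (I k)) (l 2 (J k))) I J
      + complex_of_real (Z12 * Z34 / (2 * m\<^sup>2) - Z12 / (2 * m) - Z34 / (2 * m)) * x *
        symmetrize (\<lambda>I J. (\<Prod>k\<in>{1, 2, 3}. angle_br (l 1 (I k)) (l 2 (J k)))
          * (\<Prod>k\<in>{4}. sandwich (l 1 (I k)) lP ltP (lt 2 (J k)) / complex_of_real m)) I J
      + complex_of_real (Z12 * Z34 / (4 * m\<^sup>2)) * x *
        symmetrize (\<lambda>I J. (\<Prod>k\<in>{1, 2}. angle_br (l 1 (I k)) (l 2 (J k)))
          * (\<Prod>k\<in>{3, 4}. sandwich (l 1 (I k)) lP ltP (lt 2 (J k)) / complex_of_real m)) I J)"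
proof -
  note angle = assms(2) and square = assms(3) and conservation = assms(6) and x_def = assms(8)
  have m: "complex_of_real m \<noteq> 0" using \<open>m > 0\<close> by simp
  let ?p = "\<lambda>i. massive_momentum (l i) (lt i)"
  define A B where "A = (\<lambda>K L. angle_br (l 1 K) (l 2 L))"
    and "B = (\<lambda>K L. sandwich (l 1 K) lP ltP (lt 2 L) / complex_of_real m)"
  have total: "?p 1 *v v + ?p 2 *v v + massless_momentum lP ltP *v v = 0" for v
    using conservation by (simp only: matrix_vector_mult_add_rdistrib[symmetric]) simp
  have p1: "?p 1 *v raise_index ltP = (complex_of_real m * x) *s lP"
    using x_def m by (simp add: vec_eq_iff field_simps)
  \<comment> \<open>The massless momentum annihilates its own spinor, so conservation gives
    \<open>?p 2\<close> the opposite eigenvalue to \<open>?p 1\<close>. This is the origin of the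
    relative sign between \<open>sq1\<close> and \<open>sq2\<close>.\<close>
  have "square_br ltP ltP = 0" by (simp add: square_br_eq)
  then have "?p 2 *v raise_index ltP = - (?p 1 *v raise_index ltP)"
    using total[of "raise_index ltP"]
    by (simp add: massless_momentum_mult add_eq_0_iff)
  then have p2: "?p 2 *v raise_index ltP = (- complex_of_real m * x) *s lP"
    unfolding p1 by simp
  have sq1: "square_br (lt 1 K) ltP = x * angle_br lP (l 1 K)" for K
  proof -
    have "- complex_of_real m * square_br (lt 1 K) ltP = complex_of_real m * x * angle_br (l 1 K) lP"
      using angle_br_massive_momentum_left[of "l 1" "complex_of_real m" K "lt 1" ltP, OF angle]
      unfolding p1 angle_br_scale_right by simp
    then have "complex_of_real m * square_br (lt 1 K) ltP
        = complex_of_real m * (x * angle_br lP (l 1 K))"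
      using angle_br_skew[of lP "l 1 K"] by algebra
    then show ?thesis by (simp only: mult_left_cancel[OF m])
  qed
  have sq2: "square_br (lt 2 K) ltP = - (x * angle_br lP (l 2 K))" for K
  proof -
    have "- complex_of_real m * square_br (lt 2 K) ltP = - complex_of_real m * x * angle_br (l 2 K) lP"
      using angle_br_massive_momentum_left[of "l 2" "complex_of_real m" K "lt 2" ltP, OF angle]
      unfolding p2 angle_br_scale_right by (rule sym)
    then have "complex_of_real m * square_br (lt 2 K) ltP
        = complex_of_real m * (- (x * angle_br lP (l 2 K)))"
      using angle_br_skew[of lP "l 2 K"] by algebra
    then show ?thesis by (simp only: mult_left_cancel[OF m])
  qed
  \<comment> \<open>Momentum conservation contracted with \<open>l 1 K\<close> on the left and
    \<open>lt 2 L\<close> on the right, using the Weyl equation on each massive leg.\<close>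
  have AB: "square_br (lt 1 K) (lt 2 L) = A K L + B K L" for K L
  proof -
    have "angle_br (l 1 K) (?p 1 *v raise_index (lt 2 L) + ?p 2 *v raise_index (lt 2 L)
        + massless_momentum lP ltP *v raise_index (lt 2 L)) = 0"
      unfolding total by (simp add: angle_br_eq)
    then have "- complex_of_real m * square_br (lt 1 K) (lt 2 L) + complex_of_real m * A K L
        + square_br ltP (lt 2 L) * angle_br (l 1 K) lP = 0"
      by (simp only: angle_br_add_right massless_momentum_mult angle_br_scale_right A_def
          angle_br_massive_momentum_left[OF angle] angle_br_massive_momentum_right[OF square])
    then show ?thesis using m by (simp add: B_def sandwich_def field_simps)
  qed
  define d h g where "d = (\<lambda>i K. angle_br lP (l i K))"
    and "h = (\<lambda>i K. 1 / angle_br \<zeta> lP * angle_br \<zeta> (l i K))"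
    and "g = (\<lambda>i K. 1 / square_br \<xi> ltP * (square_br \<xi> (lt i K) * leg_sign i))"
  have lin: "supercharge_delta l lP = linform d" "calH l lP \<zeta> = linform h"
      "calH_bar lt ltP \<xi> = linform g"
    unfolding d_def h_def g_def gconst_mult_linform[symmetric]
    by (simp_all add: fun_eq_iff supercharge_delta_def calH_def calH_bar_def linform_def)
  have Q: "d 1 K * h 2 L - d 2 L * h 1 K = - A K L" for K L
    using angle_br_schouten[of lP "l 1 K" \<zeta> "l 2 L"] \<open>angle_br \<zeta> lP \<noteq> 0\<close>
    by (simp add: d_def h_def A_def field_simps)
  \<comment> \<open>By \<open>sq1\<close> and \<open>sq2\<close>, \<open>x\<close> turns the
    coefficients of \<delta> into square brackets; their relative sign matches
    \<open>leg_sign\<close>, so the Schouten identity applies and cancels \<xi>.\<close>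
  have R: "x * (d 1 K * g 2 L - d 2 L * g 1 K) = - (A K L + B K L)" for K L
  proof -
    have "x * (d 1 K * g 2 L - d 2 L * g 1 K) = - (square_br (lt 1 K) ltP * square_br \<xi> (lt 2 L)
        - square_br (lt 2 L) ltP * square_br \<xi> (lt 1 K)) / square_br \<xi> ltP"
      unfolding sq1 sq2 using \<open>square_br \<xi> ltP \<noteq> 0\<close>
      by (simp add: d_def g_def leg_sign_def field_simps)
    also have "\<dots> = - square_br (lt 1 K) (lt 2 L)"
      unfolding square_br_schouten using \<open>square_br \<xi> ltP \<noteq> 0\<close> by simp
    finally show ?thesis unfolding AB .
  qed
  have sc: "complex_of_real (cos \<theta> * sin \<theta>) = complex_of_real (Z / (4 * m))"
    if "sin (2 * \<theta>) = Z / (2 * m)" for \<theta> Z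
  proof -
    have "cos \<theta> * sin \<theta> = Z / (4 * m)"
      using that \<open>m > 0\<close> unfolding sin_double by (simp add: field_simps)
    then show ?thesis by (simp only:)
  qed
  \<comment> \<open>With the double-angle formula \<open>sc\<close>, these are the products of
    cosine and sine, so \<open>2 * q\<close> is \<open>Z12 / (2 * m)\<close> and likewise for
    \<open>r\<close>.\<close>
  define q r where "q = complex_of_real (Z12 / (4 * m))" and "r = complex_of_real (Z34 / (4 * m))"
  define F where "F = (\<lambda>q a b (I :: 4 \<Rightarrow> 2) (J :: 4 \<Rightarrow> 2). A (I a) (J a) * A (I b) (J b)
      - q * (A (I a) (J a) * (A (I b) (J b) + B (I b) (J b))
           + (A (I a) (J a) + B (I a) (J a)) * A (I b) (J b)))"
  \<comment> \<open>In the tensor \<open>R\<close> always comes with a factor \<open>x\<close>, so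
    the relation for \<open>x * R\<close> suffices; all signs of the minors cancel in pairs.\<close>
  have factor: "(- a) * (- a') - x * t * ((- a) * u' + u * (- a')) = a * a' - t * (a * y' + y * a')"
    if "x * u = - y" "x * u' = - y'" for a a' u u' y y' t
    using that by algebra
  have tensor: "spin2_tensor (superamplitude e m x \<theta>12 \<theta>34
        (supercharge_delta l lP) (calH l lP \<zeta>) (calH_bar lt ltP \<xi>))
      = (\<lambda>I J. e / complex_of_real m ^ 3 * x * F q 1 2 I J * F r 3 4 I J)"
    unfolding lin
    by (intro ext, unfold spin2_tensor_superamplitude Q sc[OF assms(17)] sc[OF assms(18)])
      (simp only: F_def q_def r_def factor[OF R R])
  have coefficients:
    "complex_of_real ((1 - Z12 / (2 * m)) * (1 - Z34 / (2 * m))) = (1 - 2 * q) * (1 - 2 * r)"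
    "complex_of_real (Z12 * Z34 / (2 * m\<^sup>2) - Z12 / (2 * m) - Z34 / (2 * m))
      = 8 * q * r - 2 * q - 2 * r"
    "complex_of_real (Z12 * Z34 / (4 * m\<^sup>2)) = 4 * q * r"
    using m by (simp_all add: q_def r_def field_simps power2_eq_square)
  show ?thesis
    unfolding coefficients spin2_component_def tensor F_def symmetrize_pair_factors
    by (simp only: A_def B_def distrib_left mult_ac)
qed

end
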